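(* For every non-negative integer $n$, $p_{2,3}(n)-p_{4,6}(n-1)$ equals the number of partitions of $n$ into parts $\equiv \pm2,\pm8,\pm12,\pm14 \pmod{32}$.
   Context: A partition of $n$ is a finite multiset of positive integers summing to $n$. For positive integers $A,a$ and a partition $\pi$, $\mathrm{mex}_{A,a}(\pi)$ is the smallest element of $\{a,a+A,a+2A,\dots\}$ that is not a part of $\pi$. $p_{A,a}(n)$ is the number of partitions $\pi$ of $n$ with $\mathrm{mex}_{A,a}(\pi)\equiv a \pmod{2A}$; by convention $p_{A,a}(0)=1$ and $p_{A,a}(m)=0$ for $m<0$. *)

theory Defs
  imports Complex_Main "HOL-Library.Multiset" "HOL-Number_Theory.Cong"
begin

definition partitions :: "nat \<Rightarrow> nat multiset set" where
  "partitions n = {\<pi>. (\<forall>x\<in>#\<pi>. x > 0) \<and> sum_mset \<pi> = n}"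

lemma size_le_sum_mset:
  fixes \<pi> :: "nat multiset"
  assumes "\<forall>x\<in>#\<pi>. x > 0"
  shows "size \<pi> \<le> sum_mset \<pi>"
  using assms by (induction \<pi>) auto

lemma finite_partitions: "finite (partitions n)"
proof (rule finite_subset)
  show "partitions n \<subseteq> mset ` {xs. set xs \<subseteq> {..n} \<and> length xs \<le> n}"
  proof
    fix \<pi> assume \<pi>: "\<pi> \<in> partitions n"
    obtain xs where xs: "\<pi> = mset xs"
      by (metis ex_mset)
    have "length xs \<le> n"
      using size_le_sum_mset[of \<pi>] \<pi> xs by (simp add: partitions_def)
    moreover have "set xs \<subseteq> {..n}"
      using \<pi> xs by (auto simp: partitions_def sum_mset_sum_list intro: member_le_sum_list)
    ultimately show "\<pi> \<in> mset ` {xs. set xs \<subseteq> {..n} \<and> length xs \<le> n}"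
      using xs by auto
  qed
  show "finite (mset ` {xs. set xs \<subseteq> {..n} \<and> length xs \<le> n})"
    by (intro finite_imageI finite_lists_length_le) simp
qed

(* Meaningful for A > 0 and a > 0: the progression is then infinite and the multiset of
   parts is finite, so the least element exists. *)
definition mex :: "nat \<Rightarrow> nat \<Rightarrow> nat multiset \<Rightarrow> nat" where
  "mex A a \<pi> = (LEAST x. x \<in> {a + k * A | k. True} \<and> x \<notin># \<pi>)"

(* The argument is an integer because p is extended by zero to negative arguments.
   The convention that p A a 0 = 1 needs no separate clause: the empty partition has mex a. *)
definition p :: "nat \<Rightarrow> nat \<Rightarrow> int \<Rightarrow> nat" where
  "p A a m = (if m < 0 then 0
     else card {\<pi> \<in> partitions (nat m). [mex A a \<pi> = a] (mod (2 * A))})"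

end

theory Submission
  imports Defs "HOL-Computational_Algebra.Formal_Power_Series"
begin

text \<open>
  Write \<open>(S)\<close> for the product of \<open>1 - q^k\<close> and \<open>[S]\<close> for the product of \<open>1 + q^k\<close> over \<open>k \<in> S\<close>, and let
  \<open>\<phi>(q)\<close> be the sum of \<open>q^(k^2)\<close> over all integers \<open>k\<close>. Inclusion-exclusion over the progression
  \<open>a, a + A, \<dots>\<close> shows that \<open>p A a\<close> has generating function
  \<open>\<Sum>j. (-1)^j q^(j a + A j (j - 1) / 2)\<close> divided by \<open>(all)\<close>, so that twice \<open>q\<close> times the generating
  function of the left-hand side is \<open>(\<phi>(-q^2) - \<phi>(-q)) / (all)\<close>. By Gauss' product for \<open>\<phi>\<close> this
  is \<open>[odd] - (odd)\<close>. The Jacobi triple product turns \<open>(4\<nat>) [odd]\<close> into the sum of \<open>q^(2k^2 - k)\<close>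
  and \<open>(4\<nat>) (odd)\<close> into the same sum with signs \<open>(-1)^k\<close>; only odd \<open>k = 1 - 2m\<close> survive in
  the difference, which is \<open>2q\<close> times the sum of \<open>q^(8m^2 - 6m)\<close>. A last use of the triple product
  makes this a product, and regrouping residues modulo 32 finishes the proof.
\<close>

section \<open>Truncated equality and infinite products\<close>

text \<open>Congruence modulo \<open>fps_X ^ Suc N\<close>; together with
  \<open>agree_imp_eq\<close> it stands in for convergence of infinite products and sums.\<close>

definition agree :: "nat \<Rightarrow> 'a::comm_ring_1 fps \<Rightarrow> 'a fps \<Rightarrow> bool" where
  "agree N f g \<longleftrightarrow> (\<forall>i\<le>N. fps_nth f i = fps_nth g i)"

lemma agree_refl [simp]: "agree N f f"
  by (simp add: agree_def)

lemma agree_sym: "agree N f g \<Longrightarrow> agree N g f"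
  by (simp add: agree_def)

lemma agree_trans [trans]: "agree N f g \<Longrightarrow> agree N g h \<Longrightarrow> agree N f h"
  by (simp add: agree_def)

lemma agree_mono: "agree N f g \<Longrightarrow> M \<le> N \<Longrightarrow> agree M f g"
  by (simp add: agree_def)

lemma agree_mult: "agree N f f' \<Longrightarrow> agree N g g' \<Longrightarrow> agree N (f * g) (f' * g')"
  by (auto simp: agree_def fps_mult_nth intro!: sum.cong)

lemma agree_sum: "(\<And>i. i \<in> I \<Longrightarrow> agree N (f i) (g i)) \<Longrightarrow> agree N (sum f I) (sum g I)"
  by (auto simp: agree_def fps_sum_nth intro!: sum.cong)

lemma agree_prod: "(\<And>i. i \<in> I \<Longrightarrow> agree N (f i) (g i)) \<Longrightarrow> agree N (prod f I) (prod g I)"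
  by (induction I rule: infinite_finite_induct) (auto intro: agree_mult)

text \<open>The gain of \<open>n\<close> in precision is what makes the error estimate in the triple
  product work.\<close>

lemma agree_X_power_mult:
  "agree N f g \<Longrightarrow> agree (n + N) (fps_X ^ n * f) (fps_X ^ n * g)"
  by (auto simp: agree_def fps_X_power_mult_nth)

lemma agree_imp_eq: "(\<And>N. agree N f g) \<Longrightarrow> f = g"
  by (auto simp: agree_def fps_eq_iff)

text \<open>
  The infinite product over \<open>S\<close>, read off coefficientwise from its truncations; a member \<open>0\<close> of \<open>S\<close>
  is ignored.
\<close>
definition qprod :: "int \<Rightarrow> nat set \<Rightarrow> int fps" where
  "qprod \<epsilon> S = Abs_fps (\<lambda>n. fps_nth (\<Prod>k\<in>S \<inter> {1..n}. 1 + fps_const \<epsilon> * fps_X ^ k) n)"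

text \<open>A factor with k > n does not affect coefficients up to n. The freedom in
  \<open>F\<close> admits truncations indexed in other ways, such as by a progression.\<close>

lemma agree_qprod:
  assumes "S \<inter> {1..N} \<subseteq> F" "F \<subseteq> S - {0}" "finite F"
  shows "agree N (qprod \<epsilon> S) (\<Prod>k\<in>F. 1 + fps_const \<epsilon> * fps_X ^ k)"
  unfolding agree_def
proof (intro allI impI)
  fix n assume n: "n \<le> N"
  let ?f = "\<lambda>k. 1 + fps_const \<epsilon> * fps_X ^ k :: int fps"
  let ?G = "S \<inter> {1..n}"
  have sub: "?G \<subseteq> F" using assms(1) n by auto
  have "agree n (\<Prod>k\<in>F - ?G. ?f k) (\<Prod>k\<in>F - ?G. 1)"
  proof (rule agree_prod)
    fix k assume "k \<in> F - ?G"
    with assms(2) have "k > n" by auto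
    then show "agree n (?f k) 1"
      by (auto simp: agree_def fps_X_power_nth)
  qed
  then have "agree n ((\<Prod>k\<in>F - ?G. ?f k) * (\<Prod>k\<in>?G. ?f k)) ((\<Prod>k\<in>F - ?G. 1) * (\<Prod>k\<in>?G. ?f k))"
    by (rule agree_mult) simp
  moreover have "(\<Prod>k\<in>F. ?f k) = (\<Prod>k\<in>F - ?G. ?f k) * (\<Prod>k\<in>?G. ?f k)"
    by (rule prod.subset_diff[OF sub assms(3)])
  ultimately show "fps_nth (qprod \<epsilon> S) n = fps_nth (\<Prod>k\<in>F. ?f k) n"
    by (simp add: agree_def qprod_def)
qed

lemma agree_qprod': "agree N (qprod \<epsilon> S) (\<Prod>k\<in>S \<inter> {1..N}. 1 + fps_const \<epsilon> * fps_X ^ k)"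
  by (rule agree_qprod) auto

lemma qprod_Un:
  assumes "S \<inter> T \<subseteq> {0}"
  shows "qprod \<epsilon> (S \<union> T) = qprod \<epsilon> S * qprod \<epsilon> T"
proof (rule agree_imp_eq)
  fix N
  let ?f = "\<lambda>k. 1 + fps_const \<epsilon> * fps_X ^ k :: int fps"
  have "(\<Prod>k\<in>(S \<union> T) \<inter> {1..N}. ?f k) = (\<Prod>k\<in>S \<inter> {1..N}. ?f k) * (\<Prod>k\<in>T \<inter> {1..N}. ?f k)"
    unfolding Int_Un_distrib2 using assms by (intro prod.union_disjoint) auto
  then have "agree N (qprod \<epsilon> (S \<union> T)) \<dots>"
    using agree_qprod'[of N \<epsilon> "S \<union> T"] by simp
  also have "agree N \<dots> (qprod \<epsilon> S * qprod \<epsilon> T)"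
    by (intro agree_mult agree_sym[OF agree_qprod'])
  finally show "agree N (qprod \<epsilon> (S \<union> T)) (qprod \<epsilon> S * qprod \<epsilon> T)" .
qed

lemma qprod_plus_minus: "qprod 1 S * qprod (- 1) S = qprod (- 1) ((*) 2 ` S)"
proof (rule agree_imp_eq)
  fix N
  have "agree N (qprod 1 S * qprod (- 1) S)
     ((\<Prod>k\<in>S \<inter> {1..N}. 1 + fps_const 1 * fps_X ^ k) * (\<Prod>k\<in>S \<inter> {1..N}. 1 + fps_const (- 1) * fps_X ^ k))"
    by (intro agree_mult agree_qprod')
  also have "((\<Prod>k\<in>S \<inter> {1..N}. 1 + fps_const 1 * fps_X ^ k) * (\<Prod>k\<in>S \<inter> {1..N}. 1 + fps_const (- 1) * fps_X ^ k))
    = (\<Prod>k\<in>S \<inter> {1..N}. 1 + fps_const (- 1) * (fps_X ^ (2 * k)) :: int fps)"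
    unfolding prod.distrib[symmetric]
    by (intro prod.cong refl) (simp add: algebra_simps mult_2_right power_add flip: fps_const_neg)
  also have "\<dots> = (\<Prod>k\<in>(*) 2 ` (S \<inter> {1..N}). 1 + fps_const (- 1) * fps_X ^ k)"
    by (subst prod.reindex) (auto simp: inj_on_def)
  \<comment> \<open>The doubled truncation reaches beyond \<open>N\<close>, which
    \<open>agree_qprod\<close> allows.\<close>
  also have "agree N (\<dots>) (qprod (- 1) ((*) 2 ` S))"
    by (intro agree_sym[OF agree_qprod]) auto
  finally show "agree N (qprod 1 S * qprod (- 1) S) (qprod (- 1) ((*) 2 ` S))" .
qed

section \<open>Generating functions of partitions with restricted parts\<close>

definition partition_fps :: "nat set \<Rightarrow> int fps" where
  "partition_fps S = Abs_fps (\<lambda>n. int (card {\<pi> \<in> partitions n. set_mset \<pi> \<subseteq> S}))"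

text \<open>Taking \<open>\<mu>\<close> away is a bijection onto the partitions of
  \<open>n - sum_mset \<mu>\<close> with parts in \<open>S\<close>. It serves both Euler's product
  (one part) and the mex statistic (a segment of a progression).\<close>

lemma card_partitions_containing:
  assumes "set_mset \<mu> \<subseteq> S - {0}"
  shows "int (card {\<pi> \<in> partitions n. set_mset \<pi> \<subseteq> S \<and> \<mu> \<subseteq># \<pi>}) =
    fps_nth (fps_X ^ sum_mset \<mu> * partition_fps S) n"
proof (cases "sum_mset \<mu> \<le> n")
  case True
  have "bij_betw (\<lambda>\<pi>. \<pi> + \<mu>) {\<pi> \<in> partitions (n - sum_mset \<mu>). set_mset \<pi> \<subseteq> S}
    {\<pi> \<in> partitions n. set_mset \<pi> \<subseteq> S \<and> \<mu> \<subseteq># \<pi>}"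
  proof (rule bij_betwI[where g = "\<lambda>\<pi>. \<pi> - \<mu>"])
    show "(\<lambda>\<pi>. \<pi> - \<mu>) \<in> {\<pi> \<in> partitions n. set_mset \<pi> \<subseteq> S \<and> \<mu> \<subseteq># \<pi>} \<rightarrow>
      {\<pi> \<in> partitions (n - sum_mset \<mu>). set_mset \<pi> \<subseteq> S}"
      by (auto simp: partitions_def sum_mset_diff dest: in_diffD)
  qed (use assms True in \<open>auto simp: partitions_def\<close>)
  then show ?thesis
    using True by (simp add: bij_betw_same_card fps_X_power_mult_nth partition_fps_def)
next
  case False
  have "sum_mset \<mu> \<le> sum_mset \<pi>" if "\<mu> \<subseteq># \<pi>" for \<pi> :: "nat multiset"
    using that by (auto simp: mset_subset_eq_exists_conv)
  with False have "{\<pi> \<in> partitions n. set_mset \<pi> \<subseteq> S \<and> \<mu> \<subseteq># \<pi>} = {}"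
    by (auto simp: partitions_def)
  with False show ?thesis
    by (simp only:) (simp add: fps_X_power_mult_nth)
qed

text \<open>Subtracting the partitions that contain \<open>k\<close> leaves those that avoid
  it.\<close>

lemma partition_fps_remove:
  assumes "k \<in> S" "k > 0"
  shows "(1 - fps_X ^ k) * partition_fps S = partition_fps (S - {k})"
proof (rule fps_ext)
  fix n
  let ?A = "{\<pi> \<in> partitions n. set_mset \<pi> \<subseteq> S - {k}}"
  let ?B = "{\<pi> \<in> partitions n. set_mset \<pi> \<subseteq> S \<and> {#k#} \<subseteq># \<pi>}"
  have fin: "finite ?A" "finite ?B"
    by (auto intro: finite_subset[OF _ finite_partitions])
  have "{\<pi> \<in> partitions n. set_mset \<pi> \<subseteq> S} = ?A \<union> ?B"
    by auto
  moreover have "card (?A \<union> ?B) = card ?A + card ?B"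
    by (rule card_Un_disjoint[OF fin]) auto
  ultimately have "fps_nth (partition_fps S) n = int (card ?A) + int (card ?B)"
    by (simp add: partition_fps_def)
  moreover have "int (card ?B) = fps_nth (fps_X ^ k * partition_fps S) n"
    using card_partitions_containing[of "{#k#}" S n] assms by simp
  ultimately show "fps_nth ((1 - fps_X ^ k) * partition_fps S) n = fps_nth (partition_fps (S - {k})) n"
    by (simp add: left_diff_distrib partition_fps_def)
qed

text \<open>Euler's product: each factor strikes one part from \<open>S\<close>, and once all parts
  up to \<open>N\<close> are gone, only the empty partition has size at most
  \<open>N\<close>.\<close>

lemma qprod_mult_partition_fps: "qprod (- 1) S * partition_fps S = 1"
proof (rule agree_imp_eq)
  fix N
  have *: "(\<Prod>k\<in>F. 1 + fps_const (- 1) * fps_X ^ k) * partition_fps S = partition_fps (S - F)"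
    if "finite F" "F \<subseteq> S - {0}" for F
    using that
  proof (induction F)
    case (insert k F)
    then have "(\<Prod>k\<in>insert k F. 1 + fps_const (- 1) * fps_X ^ k) * partition_fps S =
      (1 - fps_X ^ k) * partition_fps (S - F)"
      by (simp add: mult.assoc flip: fps_const_neg)
    also have "\<dots> = partition_fps (S - F - {k})"
      using insert by (intro partition_fps_remove) auto
    also have "S - F - {k} = S - insert k F"
      by auto
    finally show ?case .
  qed simp
  have "agree N (qprod (- 1) S * partition_fps S)
    ((\<Prod>k\<in>S \<inter> {1..N}. 1 + fps_const (- 1) * fps_X ^ k) * partition_fps S)"
    by (intro agree_mult agree_qprod' agree_refl)
  also have "\<dots> = partition_fps (S - S \<inter> {1..N})"
    by (rule *) auto
  also have "agree N \<dots> 1"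
    unfolding agree_def
  proof (intro allI impI)
    fix n assume "n \<le> N"
    have "\<pi> = {#}" if "\<pi> \<in> partitions n" "set_mset \<pi> \<subseteq> S - S \<inter> {1..N}" for \<pi>
    proof (rule ccontr)
      assume "\<pi> \<noteq> {#}"
      then obtain x where x: "x \<in># \<pi>" by blast
      then have "x \<le> sum_mset \<pi>"
        by (metis le_add1 multi_member_split sum_mset.add_mset)
      moreover from x that have "x > 0" "sum_mset \<pi> = n" "x \<in> S - S \<inter> {1..N}"
        by (auto simp: partitions_def)
      ultimately show False using \<open>n \<le> N\<close> by auto
    qed
    then have "{\<pi> \<in> partitions n. set_mset \<pi> \<subseteq> S - S \<inter> {1..N}} = {\<pi> \<in> partitions n. \<pi> = {#}}"
      by auto
    also have "\<dots> = (if n = 0 then {{#}} else {})"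
      by (auto simp: partitions_def)
    finally have "{\<pi> \<in> partitions n. set_mset \<pi> \<subseteq> S - S \<inter> {1..N}} = (if n = 0 then {{#}} else {})" .
    then show "fps_nth (partition_fps (S - S \<inter> {1..N})) n = fps_nth 1 n"
      by (simp add: partition_fps_def)
  qed
  finally show "agree N (qprod (- 1) S * partition_fps S) 1" .
qed

section \<open>Gaussian binomial coefficients\<close>

text \<open>Defined by a q-Pascal rule to avoid division; the quotient formula follows in
  \<open>qbinomial_mult_qpoch\<close>.\<close>

fun qbinomial :: "'a::comm_ring_1 \<Rightarrow> nat \<Rightarrow> nat \<Rightarrow> 'a" where
  "qbinomial q n 0 = 1"
| "qbinomial q 0 (Suc r) = 0"
| "qbinomial q (Suc n) (Suc r) = qbinomial q n r + q ^ Suc r * qbinomial q n (Suc r)"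

lemma qbinomial_eq_0: "n < r \<Longrightarrow> qbinomial q n r = 0"
  by (induction q n r rule: qbinomial.induct) auto

text \<open>The second q-Pascal rule. In the finite triple product it adds factors of the first
  progression, while the defining recursion adds those of the second.\<close>

lemma qbinomial_Suc_Suc':
  "r \<le> n \<Longrightarrow> qbinomial q (Suc n) (Suc r) = qbinomial q n (Suc r) + q ^ (n - r) * qbinomial q n r"
proof (induction n arbitrary: r)
  case (Suc n)
  show ?case
  proof (cases r)
    case 0
    with Suc.IH[of 0] show ?thesis by (simp add: algebra_simps)
  next
    case (Suc s)
    show ?thesis
    proof (cases "Suc s \<le> n")
      case True
      \<comment> \<open>Both sides are q^(n+1); this matches the mixed terms once every coefficient
        is expanded down to level \<open>n\<close>.\<close>
      have e: "q ^ Suc (Suc s) * q ^ (n - Suc s) = q ^ (n - s) * q ^ Suc s"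
        using True by (simp flip: power_add del: power_Suc)
      have "qbinomial q (Suc (Suc n)) (Suc r) =
        qbinomial q n (Suc s) + q ^ (n - s) * qbinomial q n s
        + q ^ Suc (Suc s) * (qbinomial q n (Suc (Suc s)) + q ^ (n - Suc s) * qbinomial q n (Suc s))"
        using Suc.IH[of s] Suc.IH[of "Suc s"] True Suc by (subst qbinomial.simps(3)) simp
      also have "\<dots> = qbinomial q (Suc n) (Suc r) + q ^ (Suc n - r) * qbinomial q (Suc n) r"
        unfolding Suc qbinomial.simps(3) using e by (simp only: ring_distribs mult.assoc[symmetric] diff_Suc_Suc add_ac)
      finally show ?thesis .
    next
      case False
      with Suc.prems Suc have "n = s" by simp
      with Suc show ?thesis by (simp add: qbinomial_eq_0)
    qed
  qed
qed simp

definition qpoch :: "'a::comm_ring_1 \<Rightarrow> nat \<Rightarrow> 'a" where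
  "qpoch q n = (\<Prod>i<n. 1 - q ^ Suc i)"

lemma qpoch_0 [simp]: "qpoch q 0 = 1" by (simp add: qpoch_def)

lemma qpoch_Suc: "qpoch q (Suc n) = qpoch q n * (1 - q ^ Suc n)"
  by (simp add: qpoch_def)

text \<open>The Pascal rule reduces the induction step to (1 - q^r) + q^r (1 - q^(n+1-r)) = 1 -
  q^(n+1).\<close>

lemma qbinomial_mult_qpoch:
  "r \<le> n \<Longrightarrow> qbinomial q n r * qpoch q r * qpoch q (n - r) = qpoch q n"
proof (induction n arbitrary: r)
  case (Suc n)
  show ?case
  proof (cases r)
    case (Suc s)
    show ?thesis
    proof (cases "s = n")
      case True
      with Suc.IH[of s] Suc show ?thesis by (simp add: qbinomial_eq_0 qpoch_Suc flip: mult.assoc)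
    next
      case False
      with Suc.prems Suc have s: "s < n" by simp
      then have d: "n - s = Suc (n - Suc s)" by simp
      have e: "q ^ Suc s * q ^ (n - s) = q ^ Suc n"
        using s by (simp flip: power_add del: power_Suc)
      have "qbinomial q (Suc n) r * qpoch q r * qpoch q (Suc n - r) =
        (qbinomial q n s * qpoch q s * qpoch q (n - s)) * (1 - q ^ Suc s) +
        q ^ Suc s * (1 - q ^ (n - s)) * (qbinomial q n (Suc s) * qpoch q (Suc s) * qpoch q (n - Suc s))"
        unfolding Suc d diff_Suc_Suc qbinomial.simps qpoch_Suc by (simp add: algebra_simps)
      also have "\<dots> = qpoch q n * (1 - q ^ Suc s) + q ^ Suc s * (1 - q ^ (n - s)) * qpoch q n"
        using Suc.IH[of s] Suc.IH[of "Suc s"] s by simp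
      also have "\<dots> = qpoch q n * (1 - q ^ Suc s * q ^ (n - s))"
        by (simp only: ring_distribs mult_1_left mult_1_right) (simp add: algebra_simps)
      finally show ?thesis by (simp only: e qpoch_Suc)
    qed
  qed (simp add: qpoch_Suc)
qed simp

section \<open>The Jacobi triple product\<close>

definition triangular :: "int \<Rightarrow> int" where
  "triangular k = k * (k + 1) div 2"

lemma triangular_step: "triangular k = triangular (k - 1) + k"
proof -
  have "k * (k + 1) = (k - 1) * (k - 1 + 1) + k * 2"
    by (simp add: algebra_simps)
  then show ?thesis
    unfolding triangular_def by (metis div_mult_self1 zero_neq_numeral add.commute)
qed

lemma two_times_triangular: "2 * triangular k = k * (k + 1)"
  unfolding triangular_def by simp

lemma triangular_nonneg: "triangular k \<ge> 0"
proof -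
  have "k * (k + 1) \<ge> 0"
    by (cases "k \<ge> 0") (auto simp: mult_nonpos_nonpos)
  then show ?thesis by (simp add: triangular_def)
qed

text \<open>The exponent of Ramanujan's theta function f(q^a, q^b); \<open>nat\<close> loses
  nothing, since triangular numbers are nonnegative at negative indices too.\<close>

definition theta_exp :: "nat \<Rightarrow> nat \<Rightarrow> int \<Rightarrow> nat" where
  "theta_exp a b k = nat (int a * triangular k + int b * triangular (k - 1))"

lemma int_theta_exp: "int (theta_exp a b k) = int a * triangular k + int b * triangular (k - 1)"
  by (simp add: theta_exp_def triangular_nonneg)

text \<open>The exponent is at least its value k^2 for a = b = 1. The bound gives finite fibres and
  controls the tails in the triple product.\<close>

lemma theta_exp_ge_abs:
  assumes "a > 0" "b > 0"
  shows "\<bar>k\<bar> \<le> int (theta_exp a b k)"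
proof -
  have "\<bar>k\<bar> \<le> triangular k + triangular (k - 1)"
  proof -
    have "2 * (triangular k + triangular (k - 1)) = 2 * (k * k)"
      using two_times_triangular[of k] two_times_triangular[of "k - 1"] by (simp add: algebra_simps)
    moreover have "\<bar>k\<bar> * 1 \<le> \<bar>k\<bar> * \<bar>k\<bar>" if "k \<noteq> 0"
      using that by (intro mult_left_mono) auto
    ultimately show ?thesis
      by (cases "k = 0") (auto simp: abs_mult_self_eq)
  qed
  also have "1 * triangular k \<le> int a * triangular k"
    using assms by (intro mult_right_mono triangular_nonneg) auto
  then have "triangular k + triangular (k - 1) \<le> int a * triangular k + int b * triangular (k - 1)"
    using assms mult_right_mono[of 1 "int b" "triangular (k - 1)"] triangular_nonneg[of "k - 1"]
    by auto
  finally show ?thesis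
    by (simp add: int_theta_exp)
qed

lemma theta_exp_le_imp:
  assumes "a > 0" "b > 0" "theta_exp a b k \<le> n"
  shows "k \<in> {- int n..int n}"
  using theta_exp_ge_abs[OF assms(1,2), of k] assms(3) by auto

text \<open>For \<epsilon> = 1 or -1 this is \<epsilon>^k, negative k included.\<close>

definition theta_sign :: "int \<Rightarrow> int \<Rightarrow> int" where
  "theta_sign \<epsilon> k = (if even k then 1 else \<epsilon>)"

definition theta_term :: "int \<Rightarrow> nat \<Rightarrow> nat \<Rightarrow> int \<Rightarrow> int fps" where
  "theta_term \<epsilon> a b k = fps_const (theta_sign \<epsilon> k) * fps_X ^ theta_exp a b k"

lemma theta_sign_pred: "\<epsilon> * \<epsilon> = 1 \<Longrightarrow> \<epsilon> * theta_sign \<epsilon> (k - 1) = theta_sign \<epsilon> k"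
  by (auto simp: theta_sign_def)

lemma theta_sign_succ: "\<epsilon> * \<epsilon> = 1 \<Longrightarrow> \<epsilon> * theta_sign \<epsilon> (k + 1) = theta_sign \<epsilon> k"
  by (auto simp: theta_sign_def)

text \<open>Moving the index by one trades a new factor of the first progression for the power of
  q^(a+b) in the second Pascal rule; the bound on \<open>k\<close> keeps \<open>nat\<close>
  exact.\<close>

lemma theta_term_pred:
  assumes "\<epsilon> * \<epsilon> = 1" "k \<le> int m + 1"
  shows "fps_const \<epsilon> * fps_X ^ (a + m * (a + b)) * theta_term \<epsilon> a b (k - 1) =
    theta_term \<epsilon> a b k * (fps_X ^ (a + b)) ^ nat (int m + 1 - k)"
proof -
  have "int (a + m * (a + b) + theta_exp a b (k - 1)) =
    int (theta_exp a b k + (a + b) * nat (int m + 1 - k))"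
  proof -
    have *: "triangular (k - 1) = triangular (k - 2) + k - 1" "triangular k = triangular (k - 2) + 2 * k - 1"
      using triangular_step[of k] triangular_step[of "k - 1"] by auto
    show ?thesis
      using assms by (simp add: int_theta_exp * algebra_simps)
  qed
  then have "a + m * (a + b) + theta_exp a b (k - 1) = theta_exp a b k + (a + b) * nat (int m + 1 - k)"
    by (simp only: of_nat_eq_iff)
  then have X: "fps_X ^ (a + m * (a + b)) * fps_X ^ theta_exp a b (k - 1) =
    fps_X ^ theta_exp a b k * ((fps_X :: int fps) ^ (a + b)) ^ nat (int m + 1 - k)"
    by (simp only: power_mult[symmetric] power_add[symmetric])
  have "fps_const \<epsilon> * fps_X ^ (a + m * (a + b)) * theta_term \<epsilon> a b (k - 1) =
    fps_const (\<epsilon> * theta_sign \<epsilon> (k - 1)) * (fps_X ^ (a + m * (a + b)) * fps_X ^ theta_exp a b (k - 1))"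
    unfolding theta_term_def fps_const_mult[symmetric] by (simp only: mult_ac)
  also have "\<dots> = theta_term \<epsilon> a b k * (fps_X ^ (a + b)) ^ nat (int m + 1 - k)"
    unfolding theta_sign_pred[OF assms(1)] X theta_term_def by (simp only: mult_ac)
  finally show ?thesis .
qed

lemma theta_term_succ:
  assumes "\<epsilon> * \<epsilon> = 1" "k \<ge> - int l - 1"
  shows "fps_const \<epsilon> * fps_X ^ (b + l * (a + b)) * theta_term \<epsilon> a b (k + 1) =
    theta_term \<epsilon> a b k * (fps_X ^ (a + b)) ^ nat (int l + k + 1)"
proof -
  have "int (b + l * (a + b) + theta_exp a b (k + 1)) =
    int (theta_exp a b k + (a + b) * nat (int l + k + 1))"
    using triangular_step[of k] triangular_step[of "k + 1"] assms
    by (simp add: int_theta_exp algebra_simps)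
  then have "b + l * (a + b) + theta_exp a b (k + 1) = theta_exp a b k + (a + b) * nat (int l + k + 1)"
    by (simp only: of_nat_eq_iff)
  then have X: "fps_X ^ (b + l * (a + b)) * fps_X ^ theta_exp a b (k + 1) =
    fps_X ^ theta_exp a b k * ((fps_X :: int fps) ^ (a + b)) ^ nat (int l + k + 1)"
    by (simp only: power_mult[symmetric] power_add[symmetric])
  have "fps_const \<epsilon> * fps_X ^ (b + l * (a + b)) * theta_term \<epsilon> a b (k + 1) =
    fps_const (\<epsilon> * theta_sign \<epsilon> (k + 1)) * (fps_X ^ (b + l * (a + b)) * fps_X ^ theta_exp a b (k + 1))"
    unfolding theta_term_def fps_const_mult[symmetric] by (simp only: mult_ac)
  also have "\<dots> = theta_term \<epsilon> a b k * (fps_X ^ (a + b)) ^ nat (int l + k + 1)"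
    unfolding theta_sign_succ[OF assms(1)] X theta_term_def by (simp only: mult_ac)
  finally show ?thesis .
qed

text \<open>The sum side for \<open>m\<close> factors of the first progression and \<open>l\<close>
  of the second; separate lengths let each side grow one factor at a time.\<close>

definition finite_theta :: "int \<Rightarrow> nat \<Rightarrow> nat \<Rightarrow> nat \<Rightarrow> nat \<Rightarrow> int fps" where
  "finite_theta \<epsilon> a b m l =
    (\<Sum>k=-int l..int m. theta_term \<epsilon> a b k * qbinomial (fps_X ^ (a + b)) (m + l) (nat (int l + k)))"

text \<open>The second Pascal rule splits the sum in two: the old sum, and the old sum shifted by
  one index, which is the new factor's term times the old sum.\<close>

lemma finite_theta_Suc_left:
  assumes "\<epsilon> * \<epsilon> = 1"
  shows "finite_theta \<epsilon> a b (Suc m) l =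
    (1 + fps_const \<epsilon> * fps_X ^ (a + m * (a + b))) * finite_theta \<epsilon> a b m l"
proof -
  define Q where "Q = (fps_X :: int fps) ^ (a + b)"
  define E where "E = fps_const \<epsilon> * fps_X ^ (a + m * (a + b))"
  define u where "u = theta_term \<epsilon> a b"
  have split: "{-int l..int (Suc m)} = insert (-int l) {-int l + 1..int m + 1}" by auto
  have split': "{-int l..int (Suc m)} = insert (int m + 1) {-int l..int m}" by auto
  have first: "(\<Sum>k=-int l..int m. u k * qbinomial Q (m + l) (nat (int l + k))) =
    u (- int l) + (\<Sum>k=-int l+1..int m+1. u k * qbinomial Q (m + l) (nat (int l + k)))"
  proof -
    \<comment> \<open>The index m + 1 can be added to the old sum because its coefficient
      vanishes.\<close>
    have "qbinomial Q (m + l) (nat (int l + (int m + 1))) = 0"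
      by (rule qbinomial_eq_0) simp
    then have "(\<Sum>k=-int l..int m. u k * qbinomial Q (m + l) (nat (int l + k))) =
      (\<Sum>k=-int l..int (Suc m). u k * qbinomial Q (m + l) (nat (int l + k)))"
      unfolding split' by (subst sum.insert) auto
    then show ?thesis unfolding split by simp
  qed
  have "E * (\<Sum>k=-int l..int m. u k * qbinomial Q (m + l) (nat (int l + k))) =
    (\<Sum>k=-int l..int m. E * u k * qbinomial Q (m + l) (nat (int l + k)))"
    by (simp add: sum_distrib_left mult.assoc)
  also have "\<dots> = (\<Sum>k=-int l+1..int m+1. E * u (k - 1) * qbinomial Q (m + l) (nat (int l + k - 1)))"
    by (rule sum.reindex_bij_witness[where i = "\<lambda>k. k - 1" and j = "\<lambda>k. k + 1"]) auto
  also have "\<dots> = (\<Sum>k=-int l+1..int m+1. u k * Q ^ nat (int m + 1 - k) * qbinomial Q (m + l) (nat (int l + k - 1)))"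
    by (intro sum.cong refl) (simp add: E_def u_def Q_def theta_term_pred[OF assms])
  finally have second: "E * (\<Sum>k=-int l..int m. u k * qbinomial Q (m + l) (nat (int l + k))) = \<dots>" .
  have "finite_theta \<epsilon> a b (Suc m) l =
    u (- int l) + (\<Sum>k=-int l+1..int m+1. u k * qbinomial Q (Suc (m + l)) (nat (int l + k)))"
    unfolding finite_theta_def split u_def Q_def by simp
  also have "(\<Sum>k=-int l+1..int m+1. u k * qbinomial Q (Suc (m + l)) (nat (int l + k))) =
    (\<Sum>k=-int l+1..int m+1. u k * qbinomial Q (m + l) (nat (int l + k)) +
      u k * Q ^ nat (int m + 1 - k) * qbinomial Q (m + l) (nat (int l + k - 1)))"
  proof (intro sum.cong refl)
    fix k assume k: "k \<in> {-int l+1..int m+1}"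
    define r where "r = nat (int l + k - 1)"
    have r: "nat (int l + k) = Suc r" "r \<le> m + l" "m + l - r = nat (int m + 1 - k)"
      using k by (auto simp: r_def)
    show "u k * qbinomial Q (Suc (m + l)) (nat (int l + k)) =
      u k * qbinomial Q (m + l) (nat (int l + k)) +
      u k * Q ^ nat (int m + 1 - k) * qbinomial Q (m + l) (nat (int l + k - 1))"
      unfolding r(1) r_def[symmetric] qbinomial_Suc_Suc'[OF r(2)] r(3) by (simp add: algebra_simps)
  qed
  finally show ?thesis
    using first second unfolding sum.distrib finite_theta_def E_def[symmetric] Q_def[symmetric] u_def[symmetric]
    by (simp add: distrib_right)
qed

text \<open>Mirror image of the previous lemma, with the shift in the other direction and the
  defining Pascal rule.\<close>

lemma finite_theta_Suc_right:
  assumes "\<epsilon> * \<epsilon> = 1"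
  shows "finite_theta \<epsilon> a b m (Suc l) =
    (1 + fps_const \<epsilon> * fps_X ^ (b + l * (a + b))) * finite_theta \<epsilon> a b m l"
proof -
  define Q where "Q = (fps_X :: int fps) ^ (a + b)"
  define E where "E = fps_const \<epsilon> * fps_X ^ (b + l * (a + b))"
  define u where "u = theta_term \<epsilon> a b"
  have split: "{-int (Suc l)..int m} = insert (-int l - 1) {-int l..int m}" by auto
  have split': "{-int (Suc l)..int m} = insert (int m) {-int l - 1..int m - 1}" by auto
  have "E * (\<Sum>k=-int l..int m. u k * qbinomial Q (m + l) (nat (int l + k))) =
    (\<Sum>k=-int l..int m. E * u k * qbinomial Q (m + l) (nat (int l + k)))"
    by (simp add: sum_distrib_left mult.assoc)
  also have "\<dots> = (\<Sum>k=-int l - 1..int m - 1. E * u (k + 1) * qbinomial Q (m + l) (nat (int l + k + 1)))"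
    by (rule sum.reindex_bij_witness[where i = "\<lambda>k. k + 1" and j = "\<lambda>k. k - 1"]) (auto simp: add.assoc)
  also have "\<dots> = (\<Sum>k=-int l - 1..int m - 1. u k * Q ^ nat (int l + k + 1) * qbinomial Q (m + l) (nat (int l + k + 1)))"
    by (intro sum.cong refl) (simp add: E_def u_def Q_def theta_term_succ[OF assms])
  also have "\<dots> = (\<Sum>k=-int (Suc l)..int m. u k * Q ^ nat (int l + k + 1) * qbinomial Q (m + l) (nat (int l + k + 1)))"
  proof -
    have "qbinomial Q (m + l) (nat (int l + int m + 1)) = 0"
      by (rule qbinomial_eq_0) simp
    then show ?thesis unfolding split' by (subst sum.insert) auto
  qed
  also have "\<dots> = u (-int l - 1) +
    (\<Sum>k=-int l..int m. u k * Q ^ nat (int l + k + 1) * qbinomial Q (m + l) (nat (int l + k + 1)))"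
    unfolding split by simp
  finally have second: "E * (\<Sum>k=-int l..int m. u k * qbinomial Q (m + l) (nat (int l + k))) = \<dots>" .
  have "finite_theta \<epsilon> a b m (Suc l) =
    u (- int l - 1) + (\<Sum>k=-int l..int m. u k * qbinomial Q (Suc (m + l)) (nat (int l + k + 1)))"
    unfolding finite_theta_def split u_def Q_def by (simp add: add_ac)
  also have "(\<Sum>k=-int l..int m. u k * qbinomial Q (Suc (m + l)) (nat (int l + k + 1))) =
    (\<Sum>k=-int l..int m. u k * qbinomial Q (m + l) (nat (int l + k)) +
      u k * Q ^ nat (int l + k + 1) * qbinomial Q (m + l) (nat (int l + k + 1)))"
  proof (intro sum.cong refl)
    fix k assume k: "k \<in> {-int l..int m}"
    then have r: "nat (int l + k + 1) = Suc (nat (int l + k))"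
      by auto
    show "u k * qbinomial Q (Suc (m + l)) (nat (int l + k + 1)) =
      u k * qbinomial Q (m + l) (nat (int l + k)) +
      u k * Q ^ nat (int l + k + 1) * qbinomial Q (m + l) (nat (int l + k + 1))"
      unfolding r qbinomial.simps by (simp add: algebra_simps)
  qed
  finally show ?thesis
    using second unfolding sum.distrib finite_theta_def E_def[symmetric] Q_def[symmetric] u_def[symmetric]
    by (simp add: distrib_right)
qed

lemma finite_theta_0_0: "finite_theta \<epsilon> a b 0 0 = 1"
  by (simp add: finite_theta_def theta_term_def theta_sign_def theta_exp_def triangular_def)

lemma finite_jacobi_triple_product:
  assumes "\<epsilon> * \<epsilon> = 1"
  shows "(\<Prod>j<m. 1 + fps_const \<epsilon> * fps_X ^ (a + j * (a + b))) *
    (\<Prod>j<l. 1 + fps_const \<epsilon> * fps_X ^ (b + j * (a + b))) = finite_theta \<epsilon> a b m l"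
proof (induction l)
  case 0
  show ?case
    by (induction m) (simp_all add: finite_theta_0_0 finite_theta_Suc_left[OF assms] mult.commute)
next
  case (Suc l)
  then show ?case
    by (simp add: finite_theta_Suc_right[OF assms] mult_ac flip: Suc)
qed

lemma agree_qprod_progression:
  assumes "0 < a" "a < c"
  shows "agree m (qprod \<epsilon> {k. k mod c = a}) (\<Prod>j<m. 1 + fps_const \<epsilon> * fps_X ^ (a + j * c))"
proof -
  have "agree m (qprod \<epsilon> {k. k mod c = a}) (\<Prod>k\<in>(\<lambda>j. a + j * c) ` {..<m}. 1 + fps_const \<epsilon> * fps_X ^ k)"
  proof (rule agree_qprod)
    show "{k. k mod c = a} \<inter> {1..m} \<subseteq> (\<lambda>j. a + j * c) ` {..<m}"
    proof
      fix k assume k: "k \<in> {k. k mod c = a} \<inter> {1..m}"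
      then have "k = a + (k div c) * c"
        using div_mult_mod_eq[of k c] by simp
      \<comment> \<open>So \<open>m\<close> factors of the progression cover all its members up to
        \<open>m\<close>.\<close>
      moreover have "k div c < k"
        using k assms by (intro div_less_dividend) auto
      ultimately show "k \<in> (\<lambda>j. a + j * c) ` {..<m}"
        using k by (intro image_eqI[of _ _ "k div c"]) auto
    qed
  qed (use assms in auto)
  then show ?thesis
    using assms by (subst (asm) prod.reindex) (auto simp: inj_on_def)
qed

lemma agree_qprod_qpoch:
  assumes "0 < c" "N \<le> n"
  shows "agree N (qprod (- 1) {k. k mod c = 0}) (qpoch (fps_X ^ c) n)"
proof -
  have "agree N (qprod (- 1) {k. k mod c = 0}) (\<Prod>k\<in>(\<lambda>i. c * Suc i) ` {..<n}. 1 + fps_const (- 1) * fps_X ^ k)"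
  proof (rule agree_qprod)
    show "{k. k mod c = 0} \<inter> {1..N} \<subseteq> (\<lambda>i. c * Suc i) ` {..<n}"
    proof
      fix k assume k: "k \<in> {k. k mod c = 0} \<inter> {1..N}"
      then obtain i where i: "k = c * i" by auto
      then obtain i' where i': "i = Suc i'" using k by (cases i) auto
      have "i \<le> k" using i assms by simp
      then have "i' < n" using k i' assms by auto
      then show "k \<in> (\<lambda>i. c * Suc i) ` {..<n}"
        using i i' by blast
    qed
  qed (use assms in auto)
  then show ?thesis
    using assms by (subst (asm) prod.reindex) (auto simp: inj_on_def qpoch_def power_mult power_add simp flip: fps_const_neg)
qed

text \<open>
  Meaningful when \<open>e\<close> has finite fibres on \<open>I\<close>: an infinite fibre contributes \<open>0\<close>.
\<close>
definition weighted_series :: "('i \<Rightarrow> int) \<Rightarrow> ('i \<Rightarrow> nat) \<Rightarrow> 'i set \<Rightarrow> int fps" where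
  "weighted_series w e I = Abs_fps (\<lambda>n. \<Sum>i\<in>{i \<in> I. e i = n}. w i)"

lemma agree_weighted_series:
  assumes "{i \<in> I. e i \<le> N} \<subseteq> F" "F \<subseteq> I" "finite F"
  shows "agree N (weighted_series w e I) (\<Sum>i\<in>F. fps_const (w i) * fps_X ^ e i)"
  unfolding agree_def
proof (intro allI impI)
  fix n assume "n \<le> N"
  then have *: "{i \<in> I. e i = n} = {i \<in> F. e i = n}" using assms by auto
  have "fps_nth (\<Sum>i\<in>F. fps_const (w i) * fps_X ^ e i) n = (\<Sum>i\<in>F. if e i = n then w i else 0)"
    by (auto simp: fps_sum_nth fps_X_power_nth intro!: sum.cong)
  also have "\<dots> = (\<Sum>i\<in>{i \<in> F. e i = n}. w i)"
    using assms(3) by (simp add: sum.inter_filter)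
  finally show "fps_nth (weighted_series w e I) n = fps_nth (\<Sum>i\<in>F. fps_const (w i) * fps_X ^ e i) n"
    by (simp add: weighted_series_def *)
qed

definition theta :: "int \<Rightarrow> nat \<Rightarrow> nat \<Rightarrow> int fps" where
  "theta \<epsilon> a b = weighted_series (theta_sign \<epsilon>) (theta_exp a b) UNIV"

text \<open>
  Replacing \<open>qbinomial q (2 m) (m + k)\<close> by the inverse of the infinite product causes an error of
  degree above \<open>m - \<bar>k\<bar>\<close>; since the exponent of the \<open>k\<close>-th theta term is at least \<open>\<bar>k\<bar>\<close>, the finite
  identity gives the infinite one up to degree \<open>m\<close>.
\<close>
theorem jacobi_triple_product:
  assumes "a > 0" "b > 0" "\<epsilon> * \<epsilon> = 1"
  shows "qprod \<epsilon> {k. k mod (a + b) = a} * qprod \<epsilon> {k. k mod (a + b) = b} *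
    qprod (- 1) {k. k mod (a + b) = 0} = theta \<epsilon> a b"
proof (rule agree_imp_eq)
  fix m
  define M where "M = qprod (- 1) {k. k mod (a + b) = 0}"
  define P where "P = partition_fps {k. k mod (a + b) = 0}"
  define q where "q = (fps_X :: int fps) ^ (a + b)"
  have MP: "M * P = 1" unfolding M_def P_def by (rule qprod_mult_partition_fps)
  have coeff: "agree m (theta_term \<epsilon> a b k * qbinomial q (m + m) (nat (int m + k)) * M)
    (theta_term \<epsilon> a b k)" if k: "k \<in> {- int m..int m}" for k
  proof -
    define N where "N = m - nat \<bar>k\<bar>"
    define r where "r = nat (int m + k)"
    have r: "r \<le> m + m" "N \<le> r" "N \<le> m + m - r" "N \<le> m + m"
      using k by (auto simp: r_def N_def)
    have M: "agree N M (qpoch q n)" if "N \<le> n" for n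
      unfolding M_def q_def using assms that by (intro agree_qprod_qpoch) auto
    \<comment> \<open>The lengths r, 2m - r and 2m are all at least \<open>N\<close>, so at this
      precision each finite product may be exchanged for \<open>M\<close>; then \<open>P\<close>
      cancels one \<open>M\<close>.\<close>
    have "agree N (qbinomial q (m + m) r * M * M) (qbinomial q (m + m) r * qpoch q r * qpoch q (m + m - r))"
      by (intro agree_mult M r agree_refl)
    also have "\<dots> = qpoch q (m + m)"
      by (rule qbinomial_mult_qpoch[OF r(1)])
    also have "agree N \<dots> M"
      by (intro agree_sym[OF M] r)
    finally have "agree N (qbinomial q (m + m) r * M * M * P) (M * P)"
      by (rule agree_mult) simp
    then have "agree N (qbinomial q (m + m) r * M) 1"
      by (simp add: mult.assoc MP)
    then have "agree (theta_exp a b k + N)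
      (fps_X ^ theta_exp a b k * (qbinomial q (m + m) r * M)) (fps_X ^ theta_exp a b k * 1)"
      by (rule agree_X_power_mult)
    moreover have "m \<le> theta_exp a b k + N"
      using theta_exp_ge_abs[OF assms(1,2), of k] k by (simp add: N_def)
    ultimately have "agree m
      (fps_X ^ theta_exp a b k * (qbinomial q (m + m) r * M)) (fps_X ^ theta_exp a b k * 1)"
      by (rule agree_mono)
    then have "agree m
      (fps_const (theta_sign \<epsilon> k) * (fps_X ^ theta_exp a b k * (qbinomial q (m + m) r * M)))
      (fps_const (theta_sign \<epsilon> k) * (fps_X ^ theta_exp a b k * 1))"
      by (rule agree_mult[OF agree_refl])
    then show ?thesis
      by (simp add: theta_term_def r_def mult.assoc)
  qed
  have "agree m (qprod \<epsilon> {k. k mod (a + b) = a} * qprod \<epsilon> {k. k mod (a + b) = b} * M)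
    ((\<Prod>j<m. 1 + fps_const \<epsilon> * fps_X ^ (a + j * (a + b))) *
     (\<Prod>j<m. 1 + fps_const \<epsilon> * fps_X ^ (b + j * (a + b))) * M)"
    using assms by (intro agree_mult agree_qprod_progression agree_refl) auto
  also have "\<dots> = (\<Sum>k=-int m..int m. theta_term \<epsilon> a b k * qbinomial q (m + m) (nat (int m + k)) * M)"
    unfolding finite_jacobi_triple_product[OF assms(3)] finite_theta_def q_def sum_distrib_right ..
  also have "agree m \<dots> (\<Sum>k=-int m..int m. theta_term \<epsilon> a b k)"
    by (intro agree_sum coeff)
  also have "agree m (\<Sum>k=-int m..int m. theta_term \<epsilon> a b k) (theta \<epsilon> a b)"
    unfolding theta_def theta_term_def
  proof (intro agree_sym[OF agree_weighted_series])
    show "{k \<in> UNIV. theta_exp a b k \<le> m} \<subseteq> {- int m..int m}"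
      using theta_exp_le_imp[OF assms(1,2)] by blast
  qed auto
  finally show "agree m (qprod \<epsilon> {k. k mod (a + b) = a} * qprod \<epsilon> {k. k mod (a + b) = b} *
    qprod (- 1) {k. k mod (a + b) = 0}) (theta \<epsilon> a b)"
    unfolding M_def .
qed

section \<open>Theta series and the mex statistic\<close>

lemma weighted_series_Un:
  assumes "I \<inter> J = {}" "\<And>n. finite {i \<in> I. e i = n}" "\<And>n. finite {i \<in> J. e i = n}"
  shows "weighted_series w e (I \<union> J) = weighted_series w e I + weighted_series w e J"
proof (rule fps_ext)
  fix n
  have "{i \<in> I \<union> J. e i = n} = {i \<in> I. e i = n} \<union> {i \<in> J. e i = n}" by auto
  then show "fps_nth (weighted_series w e (I \<union> J)) n =
    fps_nth (weighted_series w e I + weighted_series w e J) n"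
    unfolding weighted_series_def using assms
    by (simp, subst sum.union_disjoint) auto
qed

lemma weighted_series_image:
  assumes "inj_on f J"
  shows "weighted_series w e (f ` J) = weighted_series (\<lambda>j. w (f j)) (\<lambda>j. e (f j)) J"
proof (rule fps_ext)
  fix n
  have "{i \<in> f ` J. e i = n} = f ` {j \<in> J. e (f j) = n}" by auto
  moreover have "inj_on f {j \<in> J. e (f j) = n}"
    using assms by (rule inj_on_subset) auto
  ultimately show "fps_nth (weighted_series w e (f ` J)) n =
    fps_nth (weighted_series (\<lambda>j. w (f j)) (\<lambda>j. e (f j)) J) n"
    unfolding weighted_series_def by (simp add: sum.reindex)
qed

lemma X_power_mult_weighted_series:
  "fps_X ^ d * weighted_series w e I = weighted_series w (\<lambda>i. d + e i) I"
proof (rule fps_ext)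
  fix n
  have "{i \<in> I. d + e i = n} = (if n < d then {} else {i \<in> I. e i = n - d})"
    by (auto simp: not_less)
  then show "fps_nth (fps_X ^ d * weighted_series w e I) n =
    fps_nth (weighted_series w (\<lambda>i. d + e i) I) n"
    by (simp add: weighted_series_def fps_X_power_mult_nth)
qed

lemma const_mult_weighted_series:
  "fps_const c * weighted_series w e I = weighted_series (\<lambda>i. c * w i) e I"
  by (rule fps_ext) (simp add: weighted_series_def sum_distrib_left)

lemma finite_theta_exp_vimage:
  assumes "a > 0" "b > 0"
  shows "finite {k \<in> S. theta_exp a b k = n}"
proof (rule finite_subset)
  show "{k \<in> S. theta_exp a b k = n} \<subseteq> {- int n..int n}"
    using theta_exp_le_imp[OF assms] by blast
qed simp

text \<open>Hence \<open>theta (- 1) a a\<close> is \<phi>(-q^a).\<close>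

lemma int_theta_exp_same: "int (theta_exp a a k) = int a * k\<^sup>2"
proof -
  have "2 * (triangular k + triangular (k - 1)) = 2 * k\<^sup>2"
    using two_times_triangular[of k] two_times_triangular[of "k - 1"]
    by (simp add: algebra_simps power2_eq_square)
  then show ?thesis
    unfolding int_theta_exp distrib_left[symmetric] by simp
qed

text \<open>The index 0 contributes 1, and the indices j + 1 and -j - 1 contribute the same term, of
  sign opposite to (-1)^j.\<close>

lemma one_minus_theta_same:
  assumes "a > 0"
  shows "1 - theta (- 1) a a = 2 * weighted_series (\<lambda>j. (- 1) ^ j) (\<lambda>j. a * (j + 1)\<^sup>2) UNIV"
proof -
  let ?w = "weighted_series (theta_sign (- 1)) (theta_exp a a)"
  let ?h = "weighted_series (\<lambda>j. (- 1) ^ j) (\<lambda>j. a * (j + 1)\<^sup>2) UNIV"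
  have UNIV: "(UNIV :: int set) = {0} \<union> (range (\<lambda>j. int j + 1) \<union> range (\<lambda>j. - int j - 1))"
  proof -
    have "k \<in> {0} \<union> (range (\<lambda>j. int j + 1) \<union> range (\<lambda>j. - int j - 1))" for k :: int
    proof -
      consider "k = 0" | "k = int (nat (k - 1)) + 1" | "k = - int (nat (- k - 1)) - 1"
        by linarith
      then show ?thesis
        by cases (simp, metis UnI1 UnI2 rangeI, metis UnI2 rangeI)
    qed
    then show ?thesis by (simp only: UNIV_eq_I)
  qed
  have "theta (- 1) a a = ?w {0} + (?w (range (\<lambda>j. int j + 1)) + ?w (range (\<lambda>j. - int j - 1)))"
  proof -
    note fin = finite_theta_exp_vimage[OF assms assms]
    have "range (\<lambda>j. int j + 1) \<inter> range (\<lambda>j. - int j - 1) = {}"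
      "{0} \<inter> (range (\<lambda>j. int j + 1) \<union> range (\<lambda>j. - int j - 1)) = {}"
      by auto
    then show ?thesis
      unfolding theta_def UNIV by (simp only: weighted_series_Un fin)
  qed
  also have "?w {0} = 1"
  proof -
    have "theta_exp a a 0 = 0" by (simp add: theta_exp_def triangular_def)
    then have "{k \<in> {0}. theta_exp a a k = n} = (if n = 0 then {0} else {})" for n
      by auto
    then show ?thesis
      by (intro fps_ext) (simp add: weighted_series_def theta_sign_def)
  qed
  also have "?w (range (\<lambda>j. int j + 1)) = fps_const (- 1) * ?h"
  proof -
    have "theta_exp a a (int j + 1) = a * (j + 1)\<^sup>2" for j
      unfolding of_nat_eq_iff[symmetric, where 'a = int] int_theta_exp_same by simp
    moreover have "theta_sign (- 1) (int j + 1) = - 1 * (- 1) ^ j" for j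
      by (simp add: theta_sign_def)
    moreover have "inj (\<lambda>j. int j + 1)" by (simp add: inj_def)
    ultimately show ?thesis
      by (simp only: weighted_series_image const_mult_weighted_series)
  qed
  also have "?w (range (\<lambda>j. - int j - 1)) = fps_const (- 1) * ?h"
  proof -
    have "theta_exp a a (- int j - 1) = a * (j + 1)\<^sup>2" for j
      unfolding of_nat_eq_iff[symmetric, where 'a = int] int_theta_exp_same
      by (simp add: power2_eq_square algebra_simps)
    moreover have "theta_sign (- 1) (- int j - 1) = - 1 * (- 1) ^ j" for j
      by (simp add: theta_sign_def)
    moreover have "inj (\<lambda>j. - int j - 1)" by (simp add: inj_def)
    ultimately show ?thesis
      by (simp only: weighted_series_image const_mult_weighted_series)
  qed
  also have "fps_const (- 1) = (- 1 :: int fps)"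
    by (simp flip: fps_const_neg)
  finally show ?thesis
    by simp
qed

lemma theta_1_3_odd_part: "theta 1 1 3 - theta (- 1) 1 3 = 2 * fps_X * theta 1 2 14"
proof -
  \<comment> \<open>Both sides equal 8m^2 - 6m + 1.\<close>
  have exp: "theta_exp 1 3 (1 - 2 * m) = 1 + theta_exp 2 14 m" for m
  proof -
    have "2 * triangular (1 - 2 * m) = 2 * ((1 - 2 * m) * (1 - m))"
      "2 * triangular (1 - 2 * m - 1) = 2 * (- m * (1 - 2 * m))"
      unfolding two_times_triangular by (simp_all add: algebra_simps)
    then have "triangular (1 - 2 * m) = (1 - 2 * m) * (1 - m)"
      "triangular (1 - 2 * m - 1) = - m * (1 - 2 * m)"
      by linarith+
    then have "int (theta_exp 1 3 (1 - 2 * m)) = (1 - 2 * m) * (1 - m) + 3 * (- m * (1 - 2 * m))"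
      unfolding int_theta_exp by simp
    also have "\<dots> = 1 + (m * (m + 1) + 7 * ((m - 1) * (m - 1 + 1)))"
      by (simp add: algebra_simps)
    also have "\<dots> = int (1 + theta_exp 2 14 m)"
      unfolding two_times_triangular[symmetric] of_nat_add int_theta_exp by simp
    finally show ?thesis by (simp only: of_nat_eq_iff)
  qed
  have "theta 1 1 3 - theta (- 1) 1 3 = weighted_series (\<lambda>k. if odd k then 2 else 0) (theta_exp 1 3) UNIV"
    by (intro fps_ext)
       (simp only: theta_def weighted_series_def fps_sub_nth fps_nth_Abs_fps sum_subtractf[symmetric],
        auto simp: theta_sign_def intro!: sum.cong)
  also have "\<dots> = weighted_series (\<lambda>k. if odd k then 2 else 0) (theta_exp 1 3) {k. odd k}"
    by (intro fps_ext, simp only: weighted_series_def fps_nth_Abs_fps,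
        rule sum.mono_neutral_right[OF finite_theta_exp_vimage]) auto
  also have "{k. odd k} = range (\<lambda>m :: int. 1 - 2 * m)"
  proof -
    have "k \<in> range (\<lambda>m :: int. 1 - 2 * m)" if "odd k" for k :: int
      using that by (intro image_eqI[of _ _ "(1 - k) div 2"]) auto
    moreover have "odd (1 - 2 * m)" for m :: int by simp
    ultimately show ?thesis by blast
  qed
  also have "weighted_series (\<lambda>k. if odd k then 2 else 0) (theta_exp 1 3) \<dots> =
    weighted_series (\<lambda>m. 2) (\<lambda>m. theta_exp 1 3 (1 - 2 * m)) UNIV"
    by (subst weighted_series_image) (simp_all add: inj_on_def)
  also have "\<dots> = fps_X ^ 1 * (fps_const 2 * theta 1 2 14)"
    unfolding theta_def const_mult_weighted_series X_power_mult_weighted_series exp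
    by (simp add: theta_sign_def)
  finally show ?thesis
    by (simp add: mult_ac numeral_fps_const)
qed

section \<open>The mex statistic by inclusion-exclusion\<close>

lemma alternating_sum_atMost: "(\<Sum>j\<le>k. (- 1) ^ j) = (if even k then 1 else 0 :: int)"
  by (induction k) auto

text \<open>If a + K A is the mex, the congruence says that K is even, which is the alternating sum
  over j \<le> K; and j \<le> K means that the first j terms of the progression are parts. Summing
  to \<open>n\<close> suffices, as a + n A exceeds \<open>n\<close> and so is not a part.\<close>

lemma mex_cong_iff:
  assumes "A > 0" "a > 0" "\<pi> \<in> partitions n"
  shows "of_bool [mex A a \<pi> = a] (mod (2 * A)) =
    (\<Sum>j\<le>n. (- 1) ^ j * of_bool (\<forall>i<j. a + i * A \<in># \<pi>) :: int)"
proof -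
  define K where "K = (LEAST k. a + k * A \<notin># \<pi>)"
  have "x \<le> n" if "x \<in># \<pi>" for x
    using that assms(3) by (auto simp: partitions_def dest!: multi_member_split)
  moreover have "n < a + n * A"
    using assms by (cases A) auto
  ultimately have n: "a + n * A \<notin># \<pi>"
    by (meson not_le)
  have K: "a + K * A \<notin># \<pi>"
    unfolding K_def by (rule LeastI[of "\<lambda>k. a + k * A \<notin># \<pi>", OF n])
  have le: "K \<le> k" if "a + k * A \<notin># \<pi>" for k
    unfolding K_def using that by (rule Least_le)
  have "mex A a \<pi> = a + K * A"
    unfolding mex_def by (rule Least_equality) (use K le in auto)
  moreover have "[a + K * A = a] (mod (2 * A)) \<longleftrightarrow> even K"
    using assms cong_add_lcancel_0_nat[of a "K * A" "2 * A"] by (simp add: cong_0_iff)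
  ultimately have "of_bool [mex A a \<pi> = a] (mod (2 * A)) = (\<Sum>j\<le>K. (- 1) ^ j :: int)"
    by (simp add: alternating_sum_atMost)
  also have "\<dots> = (\<Sum>j\<le>n. if j \<le> K then (- 1) ^ j else 0)"
    using le[OF n] by (subst sum.inter_filter[symmetric]) (auto intro: sum.cong)
  also have "(\<forall>i<j. a + i * A \<in># \<pi>) \<longleftrightarrow> j \<le> K" for j
    using K le by (meson le_less_trans not_le)
  then have "(\<Sum>j\<le>n. if j \<le> K then (- 1) ^ j else 0) =
    (\<Sum>j\<le>n. (- 1) ^ j * of_bool (\<forall>i<j. a + i * A \<in># \<pi>) :: int)"
    by (intro sum.cong) auto
  finally show ?thesis .
qed

text \<open>The terms are distinct because \<open>A\<close> is positive, so having them all as parts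
  means containing one multiset without repetitions.\<close>

lemma card_partitions_containing_progression:
  assumes "A > 0" "a > 0"
  shows "int (card {\<pi> \<in> partitions n. \<forall>i<j. a + i * A \<in># \<pi>}) =
    fps_nth (fps_X ^ (\<Sum>i<j. a + i * A) * partition_fps UNIV) n"
proof -
  let ?\<mu> = "mset_set ((\<lambda>i. a + i * A) ` {..<j})"
  have "?\<mu> \<subseteq># \<pi> \<longleftrightarrow> (\<forall>i<j. a + i * A \<in># \<pi>)" for \<pi>
    by (auto simp: subseteq_mset_def count_mset_set' Suc_le_eq)
  moreover have "sum_mset ?\<mu> = (\<Sum>i<j. a + i * A)"
    using assms sum_unfold_sum_mset[of "\<lambda>x. x" "(\<lambda>i. a + i * A) ` {..<j}"]
    by (simp add: sum.reindex inj_on_def)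
  moreover have "set_mset ?\<mu> \<subseteq> UNIV - {0}"
    using assms by auto
  ultimately show ?thesis
    using card_partitions_containing[of ?\<mu> UNIV n] by simp
qed

lemma p_eq_coeff:
  assumes "A > 0" "a > 0"
  shows "int (p A a (int n)) =
    fps_nth (partition_fps UNIV * weighted_series (\<lambda>j. (- 1) ^ j) (\<lambda>j. \<Sum>i<j. a + i * A) UNIV) n"
proof -
  let ?D = "\<lambda>j. \<Sum>i<j. a + i * A"
  \<comment> \<open>Terms with j > n therefore do not reach the coefficient of q^n.\<close>
  have D: "j \<le> ?D j" for j
    using sum_mono[of "{..<j}" "\<lambda>i. 1" "\<lambda>i. a + i * A"] assms by simp
  have "int (p A a (int n)) = (\<Sum>\<pi>\<in>partitions n. of_bool [mex A a \<pi> = a] (mod (2 * A)))"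
    by (simp add: p_def finite_partitions sum_of_bool_eq Int_def)
  also have "\<dots> = (\<Sum>\<pi>\<in>partitions n. \<Sum>j\<le>n. (- 1) ^ j * of_bool (\<forall>i<j. a + i * A \<in># \<pi>))"
    by (intro sum.cong refl mex_cong_iff assms)
  also have "\<dots> = (\<Sum>j\<le>n. (- 1) ^ j * (\<Sum>\<pi>\<in>partitions n. of_bool (\<forall>i<j. a + i * A \<in># \<pi>)))"
    by (subst sum.swap) (simp add: sum_distrib_left)
  also have "\<dots> = (\<Sum>j\<le>n. (- 1) ^ j * int (card {\<pi> \<in> partitions n. \<forall>i<j. a + i * A \<in># \<pi>}))"
    by (simp add: finite_partitions sum_of_bool_eq Int_def)
  also have "\<dots> = (\<Sum>j\<le>n. fps_nth (partition_fps UNIV * (fps_const ((- 1) ^ j) * fps_X ^ ?D j)) n)"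
    unfolding card_partitions_containing_progression[OF assms]
    by (simp add: mult.left_commute[of "partition_fps UNIV"] mult.commute[of "fps_X ^ _"])
  also have "\<dots> = fps_nth (partition_fps UNIV * (\<Sum>j\<le>n. fps_const ((- 1) ^ j) * fps_X ^ ?D j)) n"
    by (simp add: fps_sum_nth sum_distrib_left)
  also have "agree n (partition_fps UNIV * weighted_series (\<lambda>j. (- 1) ^ j) ?D UNIV)
    (partition_fps UNIV * (\<Sum>j\<le>n. fps_const ((- 1) ^ j) * fps_X ^ ?D j))"
    using D by (intro agree_mult agree_weighted_series) (auto intro: le_trans)
  then have "fps_nth (partition_fps UNIV * (\<Sum>j\<le>n. fps_const ((- 1) ^ j) * fps_X ^ ?D j)) n =
    fps_nth (partition_fps UNIV * weighted_series (\<lambda>j. (- 1) ^ j) ?D UNIV) n"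
    by (simp add: agree_def)
  finally show ?thesis .
qed

text \<open>The exponent j^2 + 2j lacks 1 to be a square; in the next lemma 2j^2 + 4j lacks 2 to be
  twice a square.\<close>

lemma sum_progression_2_3: "1 + (\<Sum>i<j. 3 + i * 2) = 1 * (j + 1 :: nat)\<^sup>2"
  by (induction j) (simp_all add: power2_eq_square)

lemma sum_progression_4_6: "2 + (\<Sum>i<j. 6 + i * 4) = 2 * (j + 1 :: nat)\<^sup>2"
  by (induction j) (simp_all add: power2_eq_square)

definition mex_difference_fps :: "int fps" where
  "mex_difference_fps = Abs_fps (\<lambda>n. int (p 2 3 (int n)) - int (p 4 6 (int n - 1)))"

text \<open>The factor q completes the square in the first series; with the q from the argument n -
  1 it makes the q^2 that the second one needs. The factor 2 gives full theta series, whose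
  constants 1 cancel.\<close>

lemma mex_difference_fps_theta:
  "2 * fps_X * mex_difference_fps = partition_fps UNIV * (theta (- 1) 2 2 - theta (- 1) 1 1)"
proof -
  let ?h = "\<lambda>A a. weighted_series (\<lambda>j. (- 1) ^ j) (\<lambda>j. \<Sum>i<j. a + i * A) UNIV"
  have lhs: "mex_difference_fps = partition_fps UNIV * ?h 2 3 - fps_X * (partition_fps UNIV * ?h 4 6)"
  proof (rule fps_ext)
    fix n
    have "int (p 4 6 (int n - 1)) = fps_nth (fps_X * (partition_fps UNIV * ?h 4 6)) n"
    proof (cases n)
      case 0
      then show ?thesis by (simp add: p_def)
    next
      case (Suc m)
      then show ?thesis using p_eq_coeff[of 4 6 m] by simp
    qed
    then show "fps_nth mex_difference_fps n =
      fps_nth (partition_fps UNIV * ?h 2 3 - fps_X * (partition_fps UNIV * ?h 4 6)) n"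
      using p_eq_coeff[of 2 3 n] by (simp add: mex_difference_fps_def)
  qed
  have "2 * fps_X * mex_difference_fps =
    partition_fps UNIV * (2 * (fps_X ^ 1 * ?h 2 3) - 2 * (fps_X ^ 2 * ?h 4 6))"
    unfolding lhs by (simp add: algebra_simps power2_eq_square)
  also have "2 * (fps_X ^ 1 * ?h 2 3) = 1 - theta (- 1) 1 1"
    unfolding X_power_mult_weighted_series sum_progression_2_3
    by (rule one_minus_theta_same[symmetric]) simp
  also have "2 * (fps_X ^ 2 * ?h 4 6) = 1 - theta (- 1) 2 2"
    unfolding X_power_mult_weighted_series sum_progression_4_6
    by (rule one_minus_theta_same[symmetric]) simp
  finally show ?thesis by simp
qed

section \<open>The product side\<close>

text \<open>Integer power series form an integral domain, so a nonzero factor cancels.\<close>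

lemma qprod_minus_cancel: "qprod (- 1) S * f = qprod (- 1) S * g \<longleftrightarrow> f = g"
proof -
  have "qprod (- 1) S \<noteq> 0"
    using qprod_mult_partition_fps[of S] by auto
  then show ?thesis by simp
qed

lemma qprod_residues_Un:
  "R \<inter> R' = {} \<Longrightarrow>
    qprod \<epsilon> {k. k mod c \<in> R} * qprod \<epsilon> {k. k mod c \<in> R'} = qprod \<epsilon> {k. k mod c \<in> R \<union> R'}"
  by (subst qprod_Un[symmetric]) (auto intro!: arg_cong[of _ _ "qprod \<epsilon>"])

lemma image_double_residues:
  fixes c :: nat
  shows "(*) 2 ` {k. k mod c \<in> R} = {k. k mod (2 * c) \<in> (*) 2 ` R}"
proof (intro equalityI subsetI)
  fix k assume "k \<in> {k. k mod (2 * c) \<in> (*) 2 ` R}"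
  then obtain r where r: "r \<in> R" "k mod (2 * c) = 2 * r" by auto
  then have "even k" by (metis dvd_mod_iff dvd_triv_left)
  then obtain j where j: "k = 2 * j" by blast
  with r have "j mod c = r" by (simp add: mult_mod_right[symmetric])
  with r j show "k \<in> (*) 2 ` {k. k mod c \<in> R}" by auto
qed (auto simp: mult_mod_right[symmetric])

text \<open>The last hypothesis is a finite check, stated over a list so that evaluation can decide
  it.\<close>

lemma refine_residues:
  assumes "c dvd d" "d > 0" "\<forall>r\<in>set [0..<d]. r mod c \<in> R \<longleftrightarrow> r \<in> R'"
  shows "{k :: nat. k mod c \<in> R} = {k. k mod d \<in> R'}"
proof -
  have "k mod d \<in> set [0..<d]" for k
    using assms(2) by simp
  with assms(3) have "k mod d mod c \<in> R \<longleftrightarrow> k mod d \<in> R'" for k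
    by blast
  then show ?thesis
    by (simp add: mod_mod_cancel[OF assms(1)])
qed

lemma mex_difference_fps_mult_qprod:
  "qprod (- 1) {k. k mod 32 \<in> {2, 8, 12, 14, 18, 20, 24, 30}} * mex_difference_fps = 1"
proof -
  define M where "M = (\<lambda>c R. qprod (- 1) {k. k mod c \<in> R})"
  define L where "L = (\<lambda>c R. qprod 1 {k. k mod c \<in> R})"
  have un: "M c (R \<union> R') = M c R * M c R'" "L c (R \<union> R') = L c R * L c R'"
    if "R \<inter> R' = {}" for c R R'
    using qprod_residues_Un[OF that] by (simp_all add: M_def L_def)
  have double: "L c R * M c R = M (2 * c) ((*) 2 ` R)" for c R
    unfolding L_def M_def qprod_plus_minus image_double_residues ..
  have jtp: "theta (- 1) 1 1 = M 2 {1} * M 2 {1} * M 2 {0}"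
    "theta (- 1) 2 2 = M 4 {2} * M 4 {2} * M 4 {0}"
    "theta (- 1) 1 3 = M 4 {1} * M 4 {3} * M 4 {0}"
    "theta 1 1 3 = L 4 {1} * L 4 {3} * M 4 {0}"
    "theta 1 2 14 = L 16 {2} * L 16 {14} * M 16 {0}"
    using jacobi_triple_product[of 1 1 "- 1"] jacobi_triple_product[of 2 2 "- 1"]
      jacobi_triple_product[of 1 3 "- 1"] jacobi_triple_product[of 1 3 1]
      jacobi_triple_product[of 2 14 1]
    by (simp_all add: M_def L_def del: One_nat_def)
  have odd4: "{k :: nat. k mod 4 \<in> {1} \<union> {3}} = {k. k mod 2 \<in> {1}}"
    by (rule refine_residues[symmetric]) (simp, simp, code_simp)
  have even4: "{k :: nat. k mod 4 \<in> {2} \<union> {0}} = {k. k mod 2 \<in> {0}}"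
    by (rule refine_residues[symmetric]) (simp, simp, code_simp)
  have all2: "{k :: nat. k mod 2 \<in> {1} \<union> {0}} = UNIV"
    by auto
  have M_odd: "M 4 {1} * M 4 {3} = M 2 {1}" and L_odd: "L 4 {1} * L 4 {3} = L 2 {1}"
    using un[of "{1}" "{3}" 4] odd4 by (simp_all only: M_def L_def) auto
  have M_even: "M 4 {2} * M 4 {0} = M 2 {0}"
    using un(1)[of "{2}" "{0}" 4] even4 by (simp only: M_def) auto
  have all: "M 2 {1} * M 2 {0} * partition_fps UNIV = 1"
    using un(1)[of "{1}" "{0}" 2] qprod_mult_partition_fps[of UNIV] unfolding M_def all2 by simp
  \<comment> \<open>Doubling odd numbers gives the residue 2 modulo 4.\<close>
  have LM: "L 2 {1} * M 2 {1} = M 4 {2}"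
    using double[of 2 "{1}"] by simp

  have "2 * fps_X * mex_difference_fps =
    partition_fps UNIV * (M 4 {2} * (M 4 {2} * M 4 {0}) - M 2 {1} * M 2 {1} * M 2 {0})"
    unfolding mex_difference_fps_theta jtp by (simp only: mult.assoc)
  \<comment> \<open>After one \<open>M 4 {2}\<close> joins \<open>M 4 {0}\<close> and the other
    splits by \<open>LM\<close>, both terms share the full Euler product, which the partition series
    inverts.\<close>
  also have "\<dots> = (M 2 {1} * M 2 {0} * partition_fps UNIV) * (L 2 {1} - M 2 {1})"
    unfolding M_even unfolding LM[symmetric] by (simp add: algebra_simps)
  also have "\<dots> = L 2 {1} - M 2 {1}"
    unfolding all by simp
  \<comment> \<open>Multiplying by \<open>M 4 {0}\<close> completes both products over odd numbers
    to triple products of period 4.\<close>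
  finally have "2 * fps_X * (mex_difference_fps * M 4 {0}) = theta 1 1 3 - theta (- 1) 1 3"
    unfolding jtp M_odd L_odd by (simp add: left_diff_distrib flip: mult.assoc)
  then have "2 * fps_X * (mex_difference_fps * M 4 {0}) = 2 * fps_X * theta 1 2 14"
    unfolding theta_1_3_odd_part .
  then have F: "mex_difference_fps * M 4 {0} = L 16 {2, 14} * M 16 {0}"
    unfolding jtp using un(2)[of "{2}" "{14}" 16] by (simp add: insert_commute)

  define R where "R = {2, 8, 12, 14, 18, 20, 24, 30 :: nat}"
  have mod16: "{k :: nat. k mod 16 \<in> {2, 14}} = {k. k mod 32 \<in> {2, 14, 18, 30}}"
    by (rule refine_residues) (simp, simp, code_simp)
  have mod16': "{k :: nat. k mod 16 \<in> {0}} = {k. k mod 32 \<in> {0, 16}}"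
    by (rule refine_residues) (simp, simp, code_simp)
  have mod4: "{k :: nat. k mod 4 \<in> {0}} = {k. k mod 32 \<in> {0, 4, 8, 12, 16, 20, 24, 28}}"
    by (rule refine_residues) (simp, simp, code_simp)
  \<comment> \<open>A factor \<open>M 16 {2, 14}\<close> will turn \<open>L 16 {2, 14}\<close> into
    \<open>M 32 {4, 28}\<close>. Modulo 32, removing 4, 28, 0 and 16 from the residues on this side
    leaves exactly \<open>R\<close>.\<close>
  have "M 4 {0} * M 16 {2, 14} = M 32 ({0, 4, 8, 12, 16, 20, 24, 28} \<union> {2, 14, 18, 30})"
    unfolding un(1) M_def mod4 mod16 by (subst qprod_residues_Un) auto
  also have "{0, 4, 8, 12, 16, 20, 24, 28} \<union> {2, 14, 18, 30} = R \<union> ({4, 28} \<union> {0, 16 :: nat})"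
    unfolding R_def by auto
  also have "M 32 \<dots> = M 32 R * (M 32 {4, 28} * M 16 {0})"
    using mod16' by (subst un(1), simp add: R_def, subst un(1)) (simp_all add: M_def)
  finally have *: "M 4 {0} * M 16 {2, 14} = M 32 R * (M 32 {4, 28} * M 16 {0})" .
  have "M 32 {4, 28} * (M 16 {0} * (M 32 R * mex_difference_fps)) = (mex_difference_fps * M 4 {0}) * M 16 {2, 14}"
    using * by (simp add: mult_ac)
  also have "\<dots> = (L 16 {2, 14} * M 16 {2, 14}) * M 16 {0}"
    unfolding F by (simp only: mult_ac)
  also have "\<dots> = M 32 {4, 28} * (M 16 {0} * 1)"
    unfolding double by simp
  finally have "M 32 R * mex_difference_fps = 1"
    unfolding M_def qprod_minus_cancel .
  then show ?thesis
    unfolding M_def R_def .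
qed

theorem theorem3p11:
  fixes n :: nat
  shows "int (p 2 3 (int n)) - int (p 4 6 (int n - 1)) =
    int (card {\<pi> \<in> partitions n. \<forall>x\<in>#\<pi>.
      \<exists>r\<in>{2, 8, 12, 14}. [int x = r] (mod 32) \<or> [int x = - r] (mod 32)})"
proof -
  let ?S = "{k :: nat. k mod 32 \<in> {2, 8, 12, 14, 18, 20, 24, 30}}"
  \<comment> \<open>Both series are inverse to the same product.\<close>
  have "qprod (- 1) ?S * mex_difference_fps = qprod (- 1) ?S * partition_fps ?S"
    by (simp only: mex_difference_fps_mult_qprod qprod_mult_partition_fps)
  then have "mex_difference_fps = partition_fps ?S"
    by (simp only: qprod_minus_cancel)
  then have "fps_nth mex_difference_fps n = fps_nth (partition_fps ?S) n"
    by simp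
  \<comment> \<open>Modulo 32 the negatives of 2, 8, 12, 14 are 30, 24, 20, 18.\<close>
  moreover have "(\<exists>r\<in>{2, 8, 12, 14}. [int x = r] (mod 32) \<or> [int x = - r] (mod 32)) \<longleftrightarrow> x \<in> ?S" for x
  proof -
    have "int x mod 32 = int (x mod 32)" by (simp add: zmod_int)
    then show ?thesis
      unfolding cong_def by auto
  qed
  ultimately show ?thesis
    by (simp only: mex_difference_fps_def partition_fps_def fps_nth_Abs_fps subset_iff Ball_def)
qed

end
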